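(* Let $B$ be a domain of characteristic $0$ graded by an abelian group $G$. (a) For each $D \in \mathrm{HLND}(B) \setminus \{0\}$, there exists a height $1$ homogeneous prime ideal $\mathfrak{p}$ of $B$ satisfying: (i) some homogeneous element $t \in \mathfrak{p}$ satisfies $D(t) \neq 0$ and $D^2(t)=0$; (ii) $\mathbb{G}(B/\mathfrak{p}) = \mathbb{G}(\ker D)$. (b) $\bar{\mathbb{G}}(B) \subseteq \mathbb{G}(\ker D) \subseteq \mathbb{G}(B)$ for all $D \in \mathrm{HLND}(B)$. (c) If $B$ is saturated in codimension $1$ then $\mathbb{G}(\ker D) = \mathbb{G}(B)$ for all $D \in \mathrm{HLND}(B)$.
   Context: Rings are commutative, associative and unital; "domain" means integral domain. For an abelian group $G$ (written additively), a $G$-graded ring is a ring $B=\bigoplus_{i\in G}B_i$ with $B_iB_j\subseteq B_{i+j}$. For a $G$-graded domain $B$, $\mathbb{G}(B)$ is the subgroup of $G$ generated by $\{i\in G : B_i\neq 0\}$; the quotient of $B$ by a homogeneous prime ideal, and graded subrings of $B$, carry the induced $G$-gradings. A derivation $D:B\to B$ is locally nilpotent if for each $b\in B$ there is $n>0$ with $D^n(b)=0$. It is homogeneous if there is $d\in G$ with $D(B_i)\subseteq B_{i+d}$ for all $i\in G$. $\mathrm{HLND}(B)$ is the set of homogeneous locally nilpotent derivations of $B$. Let $\mathrm{Spec}^1(B)$ be the set of all prime ideals of $B$ of height $1$ (not necessarily homogeneous). For $\mathfrak{p}\in\mathrm{Spec}(B)$, $\mathbb{M}(B,\mathfrak{p})=\{i\in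 G: B_i\nsubseteq\mathfrak{p}\}$, a submonoid of $\mathbb{G}(B)$, and $\overline{\mathbb{M}}(B,\mathfrak{p})$ is the subgroup it generates. Define $\bar{\mathbb{G}}(B)=\bigcap_{\mathfrak{p}\in\mathrm{Spec}^1(B)}\overline{\mathbb{M}}(B,\mathfrak{p})$ if $\mathrm{Spec}^1(B)\neq\emptyset$, and $\bar{\mathbb{G}}(B)=\mathbb{G}(B)$ if $\mathrm{Spec}^1(B)=\emptyset$. $B$ is saturated in codimension $1$ if $\bar{\mathbb{G}}(B)=\mathbb{G}(B)$. *)

theory Defs
  imports "HOL-Algebra.Algebra" "HOL-Library.Extended_Nat"
begin

text \<open>
  The grading group \<open>G\<close> is written multiplicatively, as is the convention for
  \<^const>\<open>comm_group\<close>. A grading is a family \<open>B\<close> of subsets of the carrier of \<open>R\<close>;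
  its values outside \<^term>\<open>carrier G\<close> are irrelevant.
\<close>

locale graded_ring = degrees: comm_group G + cring R
  for G :: "('g, 'm) monoid_scheme" and R :: "('a, 'n) ring_scheme" (structure)
    and B :: "'g \<Rightarrow> 'a set" +
  assumes component_subgroup: "i \<in> carrier G \<Longrightarrow> additive_subgroup (B i) R"
    and component_mult:
      "\<lbrakk> i \<in> carrier G; j \<in> carrier G; x \<in> B i; y \<in> B j \<rbrakk> \<Longrightarrow> x \<otimes> y \<in> B (i \<otimes>\<^bsub>G\<^esub> j)"
    and direct_sum:
      "x \<in> carrier R \<Longrightarrow>
        \<exists>!f. f \<in> (\<Pi>\<^sub>E i\<in>carrier G. B i) \<and> finite {i \<in> carrier G. f i \<noteq> \<zero>} \<and>
             x = (\<Oplus>i\<in>{i \<in> carrier G. f i \<noteq> \<zero>}. f i)"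

definition char_zero :: "('a, 'n) ring_scheme \<Rightarrow> bool" where
  "char_zero R \<longleftrightarrow> (\<forall>n::nat. n > 0 \<longrightarrow> [n] \<cdot>\<^bsub>R\<^esub> \<one>\<^bsub>R\<^esub> \<noteq> \<zero>\<^bsub>R\<^esub>)"

definition homogeneous_elements :: "('g, 'm) monoid_scheme \<Rightarrow> ('g \<Rightarrow> 'a set) \<Rightarrow> 'a set" where
  "homogeneous_elements G B = (\<Union>i\<in>carrier G. B i)"

definition homogeneous_ideal ::
  "('g, 'm) monoid_scheme \<Rightarrow> ('a, 'n) ring_scheme \<Rightarrow> ('g \<Rightarrow> 'a set) \<Rightarrow> 'a set \<Rightarrow> bool" where
  "homogeneous_ideal G R B I \<longleftrightarrow> (\<exists>S \<subseteq> homogeneous_elements G B. I = Idl\<^bsub>R\<^esub> S)"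

definition degree_group ::
  "('g, 'm) monoid_scheme \<Rightarrow> ('a, 'n) ring_scheme \<Rightarrow> ('g \<Rightarrow> 'a set) \<Rightarrow> 'g set" where
  "degree_group G R B = generate G {i \<in> carrier G. B i \<noteq> {\<zero>\<^bsub>R\<^esub>}}"

text \<open>Induced gradings on a subring with carrier \<open>A\<close> and on the quotient by an ideal \<open>I\<close>.\<close>

definition subring_grading :: "('g \<Rightarrow> 'a set) \<Rightarrow> 'a set \<Rightarrow> 'g \<Rightarrow> 'a set" where
  "subring_grading B A i = B i \<inter> A"

definition quotient_grading ::
  "('a, 'n) ring_scheme \<Rightarrow> ('g \<Rightarrow> 'a set) \<Rightarrow> 'a set \<Rightarrow> 'g \<Rightarrow> 'a set set" where
  "quotient_grading R B I i = (\<lambda>x. I +>\<^bsub>R\<^esub> x) ` B i"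

text \<open>Maps are extensional, so that a derivation is determined by its values on the carrier.\<close>

definition derivations :: "('a, 'n) ring_scheme \<Rightarrow> ('a \<Rightarrow> 'a) set" where
  "derivations R = {D \<in> carrier R \<rightarrow>\<^sub>E carrier R.
     (\<forall>x\<in>carrier R. \<forall>y\<in>carrier R. D (x \<oplus>\<^bsub>R\<^esub> y) = D x \<oplus>\<^bsub>R\<^esub> D y) \<and>
     (\<forall>x\<in>carrier R. \<forall>y\<in>carrier R.
        D (x \<otimes>\<^bsub>R\<^esub> y) = (D x \<otimes>\<^bsub>R\<^esub> y) \<oplus>\<^bsub>R\<^esub> (x \<otimes>\<^bsub>R\<^esub> D y))}"

definition zero_derivation :: "('a, 'n) ring_scheme \<Rightarrow> 'a \<Rightarrow> 'a" where
  "zero_derivation R = (\<lambda>x\<in>carrier R. \<zero>\<^bsub>R\<^esub>)"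

definition locally_nilpotent :: "('a, 'n) ring_scheme \<Rightarrow> ('a \<Rightarrow> 'a) \<Rightarrow> bool" where
  "locally_nilpotent R D \<longleftrightarrow> (\<forall>b\<in>carrier R. \<exists>n>0. (D ^^ n) b = \<zero>\<^bsub>R\<^esub>)"

definition homogeneous_map ::
  "('g, 'm) monoid_scheme \<Rightarrow> ('g \<Rightarrow> 'a set) \<Rightarrow> ('a \<Rightarrow> 'a) \<Rightarrow> bool" where
  "homogeneous_map G B D \<longleftrightarrow> (\<exists>d\<in>carrier G. \<forall>i\<in>carrier G. D ` B i \<subseteq> B (i \<otimes>\<^bsub>G\<^esub> d))"

definition HLND ::
  "('g, 'm) monoid_scheme \<Rightarrow> ('a, 'n) ring_scheme \<Rightarrow> ('g \<Rightarrow> 'a set) \<Rightarrow> ('a \<Rightarrow> 'a) set" where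
  "HLND G R B = {D \<in> derivations R. locally_nilpotent R D \<and> homogeneous_map G B D}"

definition degree_group_kernel ::
  "('g, 'm) monoid_scheme \<Rightarrow> ('a, 'n) ring_scheme \<Rightarrow> ('g \<Rightarrow> 'a set) \<Rightarrow> ('a \<Rightarrow> 'a) \<Rightarrow> 'g set" where
  "degree_group_kernel G R B D =
     degree_group G (R\<lparr>carrier := a_kernel R R D\<rparr>) (subring_grading B (a_kernel R R D))"

definition degree_group_quotient ::
  "('g, 'm) monoid_scheme \<Rightarrow> ('a, 'n) ring_scheme \<Rightarrow> ('g \<Rightarrow> 'a set) \<Rightarrow> 'a set \<Rightarrow> 'g set" where
  "degree_group_quotient G R B I = degree_group G (R Quot I) (quotient_grading R B I)"

text \<open>
  The height of a prime \<open>P\<close> is the supremum of the lengths \<open>n\<close> of chains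
  \<open>C 0 \<subset> \<dots> \<subset> C n = P\<close> of prime ideals.
\<close>

definition prime_height :: "('a, 'n) ring_scheme \<Rightarrow> 'a set \<Rightarrow> enat" where
  "prime_height R P = (SUP n \<in> {n. \<exists>C. (\<forall>k\<le>n. primeideal (C k) R) \<and>
                                      (\<forall>k<n. C k \<subset> C (Suc k)) \<and> C n = P}. enat n)"

definition Spec1 :: "('a, 'n) ring_scheme \<Rightarrow> 'a set set" where
  "Spec1 R = {P. primeideal P R \<and> prime_height R P = 1}"

definition degree_monoid_at ::
  "('g, 'm) monoid_scheme \<Rightarrow> ('g \<Rightarrow> 'a set) \<Rightarrow> 'a set \<Rightarrow> 'g set" where
  "degree_monoid_at G B P = {i \<in> carrier G. \<not> B i \<subseteq> P}"

definition degree_group_at ::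
  "('g, 'm) monoid_scheme \<Rightarrow> ('g \<Rightarrow> 'a set) \<Rightarrow> 'a set \<Rightarrow> 'g set" where
  "degree_group_at G B P = generate G (degree_monoid_at G B P)"

definition codim1_degree_group ::
  "('g, 'm) monoid_scheme \<Rightarrow> ('a, 'n) ring_scheme \<Rightarrow> ('g \<Rightarrow> 'a set) \<Rightarrow> 'g set" where
  "codim1_degree_group G R B =
     (if Spec1 R = {} then degree_group G R B else (\<Inter>P\<in>Spec1 R. degree_group_at G B P))"

definition saturated_in_codim1 ::
  "('g, 'm) monoid_scheme \<Rightarrow> ('a, 'n) ring_scheme \<Rightarrow> ('g \<Rightarrow> 'a set) \<Rightarrow> bool" where
  "saturated_in_codim1 G R B \<longleftrightarrow> codim1_degree_group G R B = degree_group G R B"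

end

theory Submission
  imports Defs
begin

text \<open>
  Let \<open>A\<close> be the kernel of \<open>D\<close> and \<open>S\<close> the set of nonzero homogeneous elements of \<open>A\<close>; it contains
  the positive integers, so no divisibility by factorials is needed. Applying \<open>D\<close> repeatedly to a
  homogeneous element outside \<open>A\<close> yields a homogeneous \<open>t\<close> with \<open>D t \<noteq> 0 = D\<^sup>2 t\<close>, and then
  \<open>S\<^sup>-\<^sup>1B = (S\<^sup>-\<^sup>1A)[t]\<close>. The required prime is the contraction \<open>P\<close> of the ideal generated by \<open>t\<close>.
  It meets \<open>A\<close> in \<open>0\<close>, and every homogeneous \<open>x\<close> outside \<open>P\<close> has a multiple \<open>s x\<close> with \<open>s \<in> S\<close>
  that is congruent modulo \<open>t\<close> to a nonzero homogeneous element of \<open>A\<close>. Hence \<open>A\<close> and \<open>B/P\<close> have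
  the same degree group, which is also the group generated by the degrees \<open>i\<close> with \<open>B\<^sub>i\<close> not
  contained in \<open>P\<close>.
\<close>

section \<open>Homogeneous components\<close>

context graded_ring
begin

lemma component_subset: "i \<in> carrier G \<Longrightarrow> B i \<subseteq> carrier R"
  using component_subgroup additive_subgroup.a_subset by blast

lemma component_closed [simp]: "\<lbrakk>i \<in> carrier G; x \<in> B i\<rbrakk> \<Longrightarrow> x \<in> carrier R"
  using component_subset by blast

lemma zero_in_component: "i \<in> carrier G \<Longrightarrow> \<zero> \<in> B i"
  using component_subgroup additive_subgroup.zero_closed by blast

lemma homogeneous_closed: "x \<in> homogeneous_elements G B \<Longrightarrow> x \<in> carrier R"
  by (auto simp: homogeneous_elements_def)

lemma homogeneous_mult:
  assumes "x \<in> homogeneous_elements G B" "y \<in> homogeneous_elements G B"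
  shows "x \<otimes> y \<in> homogeneous_elements G B"
  using assms component_mult degrees.m_closed unfolding homogeneous_elements_def by blast

lemma homogeneous_add_pow:
  assumes "x \<in> homogeneous_elements G B"
  shows "[(n::nat)] \<cdot> x \<in> homogeneous_elements G B"
proof -
  obtain i where i: "i \<in> carrier G" "x \<in> B i"
    using assms by (auto simp: homogeneous_elements_def)
  have "[n] \<cdot> x \<in> B i"
  proof (induction n)
    case 0
    then show ?case using i by (simp add: zero_in_component)
  next
    case (Suc n)
    then show ?case
      using i component_subgroup[OF i(1)] additive_subgroup.a_closed by fastforce
  qed
  then show ?thesis using i by (auto simp: homogeneous_elements_def)
qed

lemma homogeneous_map_homogeneous:
  assumes "homogeneous_map G B D" "x \<in> homogeneous_elements G B"
  shows "D x \<in> homogeneous_elements G B"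
proof -
  obtain d i where "d \<in> carrier G" "\<And>i. i \<in> carrier G \<Longrightarrow> D ` B i \<subseteq> B (i \<otimes>\<^bsub>G\<^esub> d)"
    "i \<in> carrier G" "x \<in> B i"
    using assms unfolding homogeneous_map_def homogeneous_elements_def by blast
  then show ?thesis
    unfolding homogeneous_elements_def by (intro UN_I[of "i \<otimes>\<^bsub>G\<^esub> d"]) auto
qed

text \<open>The unique existence in \<open>direct_sum\<close> is for the whole family, so the
  description operator selects the family first and evaluates it at \<open>i\<close>
  afterwards.\<close>

definition homogeneous_component :: "'g \<Rightarrow> 'a \<Rightarrow> 'a" where
  "homogeneous_component i x =
     (THE f. f \<in> (\<Pi>\<^sub>E i\<in>carrier G. B i) \<and> finite {i \<in> carrier G. f i \<noteq> \<zero>} \<and>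
             x = (\<Oplus>i\<in>{i \<in> carrier G. f i \<noteq> \<zero>}. f i)) i"

abbreviation component_support :: "'a \<Rightarrow> 'g set" where
  "component_support x \<equiv> {i \<in> carrier G. homogeneous_component i x \<noteq> \<zero>}"

lemma homogeneous_component:
  assumes "x \<in> carrier R"
  shows "i \<in> carrier G \<Longrightarrow> homogeneous_component i x \<in> B i"
    and "finite (component_support x)"
    and "x = (\<Oplus>i\<in>component_support x. homogeneous_component i x)"
  using theI'[OF direct_sum[OF assms]] unfolding homogeneous_component_def by (auto simp: PiE_iff)

lemma homogeneous_component_closed [simp]:
  "\<lbrakk>x \<in> carrier R; i \<in> carrier G\<rbrakk> \<Longrightarrow> homogeneous_component i x \<in> carrier R"
  using homogeneous_component(1) component_closed by blast

text \<open>Indices outside the support contribute zero. This allows two elements to be expanded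
  over a common index set.\<close>

lemma finsum_component_superset:
  assumes "x \<in> carrier R" "finite F" "component_support x \<subseteq> F" "F \<subseteq> carrier G"
  shows "x = (\<Oplus>i\<in>F. homogeneous_component i x)"
proof -
  have "(\<Oplus>i\<in>component_support x. homogeneous_component i x) = (\<Oplus>i\<in>F. homogeneous_component i x)"
    using assms by (intro add.finprod_mono_neutral_cong_left) auto
  then show ?thesis using homogeneous_component(3)[OF assms(1)] by simp
qed

text \<open>Extending \<open>f\<close> by zero outside \<open>F\<close> gives a decomposition of the
  sum, and decompositions are unique. Components of any explicit homogeneous sum can thus be read
  off.\<close>

lemma homogeneous_component_finsum:
  assumes "finite F" "F \<subseteq> carrier G" "\<And>i. i \<in> F \<Longrightarrow> f i \<in> B i" "j \<in> carrier G"
  shows "homogeneous_component j (\<Oplus>i\<in>F. f i) = (if j \<in> F then f j else \<zero>)"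
proof -
  define h where "h = (\<lambda>i\<in>carrier G. if i \<in> F then f i else \<zero>)"
  have cl: "f i \<in> carrier R" if "i \<in> F" for i
    using that assms by (meson component_closed subsetD)
  let ?x = "\<Oplus>i\<in>F. f i"
  have x: "?x \<in> carrier R" using cl by (intro add.finprod_closed) auto
  have sub: "{i \<in> carrier G. h i \<noteq> \<zero>} \<subseteq> F" by (auto simp: h_def split: if_splits)
  have "(\<Oplus>i\<in>{i \<in> carrier G. h i \<noteq> \<zero>}. h i) = ?x"
    using assms sub cl by (intro add.finprod_mono_neutral_cong_left) (auto simp: h_def subset_iff)
  moreover have "h \<in> (\<Pi>\<^sub>E i\<in>carrier G. B i)"
    using assms zero_in_component by (auto simp: h_def)
  moreover have "finite {i \<in> carrier G. h i \<noteq> \<zero>}"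
    using sub assms(1) finite_subset by blast
  ultimately have "homogeneous_component j ?x = h j"
    unfolding homogeneous_component_def by (subst the1_equality[OF direct_sum[OF x]]) auto
  then show ?thesis using assms(4) by (simp add: h_def)
qed

lemma homogeneous_component_homogeneous:
  assumes "i \<in> carrier G" "j \<in> carrier G" "x \<in> B i"
  shows "homogeneous_component j x = (if j = i then x else \<zero>)"
  using homogeneous_component_finsum[of "{i}" "\<lambda>_. x" j] assms by simp

lemma homogeneous_component_add:
  assumes "x \<in> carrier R" "y \<in> carrier R" "j \<in> carrier G"
  shows "homogeneous_component j (x \<oplus> y) = homogeneous_component j x \<oplus> homogeneous_component j y"
proof -
  \<comment> \<open>\<open>j\<close> is inserted because both components of degree \<open>j\<close>
    may vanish.\<close>
  define F where "F = insert j (component_support x \<union> component_support y)"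
  have F: "finite F" "component_support x \<subseteq> F" "component_support y \<subseteq> F" "F \<subseteq> carrier G" "j \<in> F"
    using assms homogeneous_component(2) by (auto simp: F_def)
  have "(\<Oplus>i\<in>F. homogeneous_component i x \<oplus> homogeneous_component i y)
      = (\<Oplus>i\<in>F. homogeneous_component i x) \<oplus> (\<Oplus>i\<in>F. homogeneous_component i y)"
    using assms F by (intro add.finprod_multf) auto
  also have "\<dots> = x \<oplus> y"
    using finsum_component_superset[OF assms(1) F(1,2,4)]
      finsum_component_superset[OF assms(2) F(1,3,4)] by simp
  finally have eq: "x \<oplus> y = (\<Oplus>i\<in>F. homogeneous_component i x \<oplus> homogeneous_component i y)" by simp
  have "homogeneous_component i x \<oplus> homogeneous_component i y \<in> B i" if "i \<in> F" for i
    using that F(4) assms homogeneous_component(1)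
    by (intro additive_subgroup.a_closed[OF component_subgroup]) auto
  then show ?thesis
    unfolding eq using homogeneous_component_finsum[OF F(1,4)] F(5) assms(3) by simp
qed

lemma additive_finsum:
  assumes "\<phi> \<in> carrier R \<rightarrow> carrier R"
    and "\<And>x y. \<lbrakk>x \<in> carrier R; y \<in> carrier R\<rbrakk> \<Longrightarrow> \<phi> (x \<oplus> y) = \<phi> x \<oplus> \<phi> y"
    and "finite F" "f \<in> F \<rightarrow> carrier R"
  shows "\<phi> (\<Oplus>i\<in>F. f i) = (\<Oplus>i\<in>F. \<phi> (f i))"
  using assms(3,4)
proof (induction F rule: finite_induct)
  case empty
  have "\<phi> \<zero> \<oplus> \<phi> \<zero> = \<phi> \<zero>" using assms(2)[of \<zero> \<zero>] by simp
  moreover have "\<phi> \<zero> \<in> carrier R" using assms(1) by auto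
  ultimately have "\<phi> \<zero> = \<zero>" by simp
  then show ?case by simp
next
  case (insert i F)
  have "f \<in> F \<rightarrow> carrier R" "f i \<in> carrier R" using insert.prems by auto
  moreover have "(\<lambda>i. \<phi> (f i)) \<in> F \<rightarrow> carrier R" "\<phi> (f i) \<in> carrier R"
    using assms(1) insert.prems by auto
  ultimately show ?case
    using insert.hyps insert.IH assms(2) by simp
qed

text \<open>An additive map that translates degrees carries the decomposition of \<open>x\<close> to
  one of \<open>\<phi> x\<close>, reindexed by an injective translation. It is applied both to
  multiplication by a homogeneous element and to \<open>D\<close>.\<close>

lemma homogeneous_component_shift:
  assumes \<phi>: "\<phi> \<in> carrier R \<rightarrow> carrier R"
    and add: "\<And>x y. \<lbrakk>x \<in> carrier R; y \<in> carrier R\<rbrakk> \<Longrightarrow> \<phi> (x \<oplus> y) = \<phi> x \<oplus> \<phi> y"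
    and g: "g \<in> carrier G"
    and shift: "\<And>i x. \<lbrakk>i \<in> carrier G; x \<in> B i\<rbrakk> \<Longrightarrow> \<phi> x \<in> B (i \<otimes>\<^bsub>G\<^esub> g)"
    and x: "x \<in> carrier R" and j: "j \<in> carrier G"
  shows "homogeneous_component (j \<otimes>\<^bsub>G\<^esub> g) (\<phi> x) = \<phi> (homogeneous_component j x)"
proof -
  define F where "F = insert j (component_support x)"
  \<comment> \<open>\<open>?r\<close> undoes \<open>?s\<close>, so that the images can be indexed by
    their own degrees, the form in which their components can be read off.\<close>
  let ?s = "\<lambda>i. i \<otimes>\<^bsub>G\<^esub> g" and ?r = "\<lambda>i. i \<otimes>\<^bsub>G\<^esub> inv\<^bsub>G\<^esub> g"
  have F: "finite F" "component_support x \<subseteq> F" "F \<subseteq> carrier G" "j \<in> F"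
    using x j homogeneous_component(2) by (auto simp: F_def)
  have rs: "?r (?s i) = i" if "i \<in> carrier G" for i
    using that g by (simp add: degrees.m_assoc)
  then have inj: "inj_on ?s F" using F(3) by (intro inj_on_inverseI[of F ?r]) auto
  let ?f = "\<lambda>i. \<phi> (homogeneous_component (?r i) x)"
  have f: "?f (?s i) = \<phi> (homogeneous_component i x)" if "i \<in> F" for i
    using rs that F(3) by (metis subsetD)
  have fB: "?f i \<in> B i" if "i \<in> ?s ` F" for i
  proof -
    from that obtain k where k: "k \<in> F" "i = ?s k" by auto
    have "k \<in> carrier G" using k F(3) by blast
    then show ?thesis unfolding k(2) f[OF k(1)] using shift homogeneous_component(1)[OF x] by blast
  qed
  have sF: "?s ` F \<subseteq> carrier G" using F(3) g by auto
  have "\<phi> x = \<phi> (\<Oplus>i\<in>F. homogeneous_component i x)"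
    using finsum_component_superset[OF x F(1,2,3)] by simp
  also have "\<dots> = (\<Oplus>i\<in>F. \<phi> (homogeneous_component i x))"
    using F(1,3) x by (intro additive_finsum[OF \<phi> add]) auto
  also have "\<dots> = (\<Oplus>i\<in>F. ?f (?s i))"
    using F(3) x \<phi> rs by (intro add.finprod_cong') (auto simp: subset_iff Pi_iff)
  also have "\<dots> = (\<Oplus>i\<in>?s ` F. ?f i)"
    using fB sF component_closed inj by (subst add.finprod_reindex) (auto simp: subset_iff)
  finally have eq: "\<phi> x = (\<Oplus>i\<in>?s ` F. ?f i)" .
  show ?thesis
    unfolding eq using homogeneous_component_finsum[of "?s ` F" ?f "?s j"] F fB sF f[OF F(4)] by auto
qed

lemma homogeneous_component_mult:
  assumes s: "s \<in> B g" "g \<in> carrier G" and "x \<in> carrier R" "j \<in> carrier G"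
  shows "homogeneous_component (j \<otimes>\<^bsub>G\<^esub> g) (s \<otimes> x) = s \<otimes> homogeneous_component j x"
proof (rule homogeneous_component_shift[of "\<lambda>x. s \<otimes> x"])
  show "s \<otimes> x \<in> B (i \<otimes>\<^bsub>G\<^esub> g)" if "i \<in> carrier G" "x \<in> B i" for i x
    using component_mult[OF s(2) that(1) s(1) that(2)] s that by (simp add: degrees.m_comm)
qed (use assms in \<open>auto simp: r_distr\<close>)

section \<open>Degree groups and homogeneous ideals\<close>

text \<open>The image of \<open>B i\<close> in the quotient vanishes exactly when \<open>B i\<close>
  lies in \<open>I\<close>. Hence condition (ii) on \<open>G(B/P)\<close> is also a statement about
  one term of the intersection over height one primes.\<close>

lemma degree_group_quotient_eq:
  assumes "ideal I R"
  shows "degree_group_quotient G R B I = degree_group_at G B I"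
proof -
  interpret I: ideal I R by fact
  have "quotient_grading R B I i \<noteq> {\<zero>\<^bsub>R Quot I\<^esub>} \<longleftrightarrow> \<not> B i \<subseteq> I" if i: "i \<in> carrier G" for i
  proof -
    have "I +> x = I \<longleftrightarrow> x \<in> I" if "x \<in> B i" for x
      using I.rcos_const_imp_mem I.a_rcos_const component_closed[OF i that] by blast
    then have "quotient_grading R B I i = {I} \<longleftrightarrow> B i \<subseteq> I"
      using zero_in_component[OF i] unfolding quotient_grading_def by blast
    then show ?thesis by (simp add: FactRing_def)
  qed
  then show ?thesis
    unfolding degree_group_quotient_def degree_group_def degree_group_at_def degree_monoid_at_def
    by (metis (lifting))
qed

lemma degree_group_at_subset:
  assumes "\<zero> \<in> P"
  shows "degree_group_at G B P \<subseteq> degree_group G R B"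
  unfolding degree_group_at_def degree_group_def degree_monoid_at_def
  using assms by (intro degrees.mono_generate) auto

text \<open>An ideal closed under taking components is generated by its own homogeneous elements,
  since each member is the sum of its components.\<close>

lemma homogeneous_idealI:
  assumes I: "ideal I R"
    and "\<And>x i. \<lbrakk>x \<in> I; i \<in> carrier G\<rbrakk> \<Longrightarrow> homogeneous_component i x \<in> I"
  shows "homogeneous_ideal G R B I"
proof -
  interpret I: ideal I R by fact
  let ?S = "homogeneous_elements G B \<inter> I"
  have S: "?S \<subseteq> carrier R" using I.a_subset by blast
  interpret J: ideal "Idl ?S" R using genideal_ideal[OF S] .
  have sub: "?S \<subseteq> Idl ?S" using genideal_self[OF S] .
  have "x \<in> Idl ?S" if x: "x \<in> I" for x
  proof -
    have xR: "x \<in> carrier R" using x by simp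
    have mem: "homogeneous_component i x \<in> Idl ?S" if "i \<in> carrier G" for i
      using that assms(2)[OF x] homogeneous_component(1)[OF xR] sub
      by (auto simp: homogeneous_elements_def)
    have "F \<subseteq> carrier G \<Longrightarrow> (\<Oplus>i\<in>F. homogeneous_component i x) \<in> Idl ?S" if "finite F" for F
      using that
    proof (induction F rule: finite_induct)
      case (insert i F)
      then show ?case using mem xR by (subst finsum_insert) auto
    qed auto
    then show ?thesis
      using homogeneous_component(2,3)[OF xR] by (metis (no_types, lifting) mem_Collect_eq subsetI)
  qed
  then have "I = Idl ?S" using genideal_minimal[OF I, of ?S] by blast
  then show ?thesis unfolding homogeneous_ideal_def by blast
qed

end

section \<open>Derivations, their constants and their iterates\<close>

locale derivation = cring R for R :: "('a, 'n) ring_scheme" (structure) +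
  fixes D :: "'a \<Rightarrow> 'a"
  assumes derivation: "D \<in> derivations R"
begin

lemma D_closed [simp, intro]: "x \<in> carrier R \<Longrightarrow> D x \<in> carrier R"
  using derivation by (auto simp: derivations_def)

lemma D_add: "\<lbrakk>x \<in> carrier R; y \<in> carrier R\<rbrakk> \<Longrightarrow> D (x \<oplus> y) = D x \<oplus> D y"
  using derivation by (auto simp: derivations_def)

lemma D_mult: "\<lbrakk>x \<in> carrier R; y \<in> carrier R\<rbrakk> \<Longrightarrow> D (x \<otimes> y) = D x \<otimes> y \<oplus> x \<otimes> D y"
  using derivation by (auto simp: derivations_def)

lemma D_zero [simp]: "D \<zero> = \<zero>"
  using D_add[of \<zero> \<zero>] by simp

lemma D_one [simp]: "D \<one> = \<zero>"
  using D_mult[of \<one> \<one>] by simp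

lemma D_add_pow: "x \<in> carrier R \<Longrightarrow> D ([(n::nat)] \<cdot> x) = [n] \<cdot> D x"
  by (induction n) (auto simp: D_add)

lemma D_uminus: "x \<in> carrier R \<Longrightarrow> D (\<ominus> x) = \<ominus> D x"
  by (metis D_add D_closed D_zero a_inv_closed add.inv_equality l_neg)

lemma D_pow_closed [simp, intro]: "x \<in> carrier R \<Longrightarrow> (D ^^ n) x \<in> carrier R"
  by (induction n) auto

lemma D_pow_zero [simp]: "(D ^^ n) \<zero> = \<zero>"
  by (induction n) auto

lemma D_pow_add:
  "\<lbrakk>x \<in> carrier R; y \<in> carrier R\<rbrakk> \<Longrightarrow> (D ^^ n) (x \<oplus> y) = (D ^^ n) x \<oplus> (D ^^ n) y"
  by (induction n) (auto simp: D_add)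

lemma D_pow_uminus: "x \<in> carrier R \<Longrightarrow> (D ^^ n) (\<ominus> x) = \<ominus> (D ^^ n) x"
  by (induction n) (auto simp: D_uminus)

lemma D_pow_eq_zero_mono: "\<lbrakk>(D ^^ m) x = \<zero>; m \<le> n\<rbrakk> \<Longrightarrow> (D ^^ n) x = \<zero>"
  by (metis D_pow_zero funpow_add le_add_diff_inverse2 o_apply)

abbreviation constants :: "'a set" where
  "constants \<equiv> a_kernel R R D"

lemma constants_iff: "x \<in> constants \<longleftrightarrow> x \<in> carrier R \<and> D x = \<zero>"
  by (auto simp: a_kernel_def')

lemma constants_mult: "\<lbrakk>x \<in> constants; y \<in> constants\<rbrakk> \<Longrightarrow> x \<otimes> y \<in> constants"
  by (simp add: constants_iff D_mult)

lemma D_pow_constant_mult: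
  "\<lbrakk>s \<in> constants; x \<in> carrier R\<rbrakk> \<Longrightarrow> (D ^^ n) (s \<otimes> x) = s \<otimes> (D ^^ n) x"
  by (induction n) (auto simp: constants_iff D_mult)

text \<open>In the Leibniz formula for iterates only the terms with at most one derivative on
  \<open>t\<close> survive, because \<open>D (D t)\<close> is zero. The exponent
  \<open>Suc n\<close> keeps the second term free of a truncated subtraction.\<close>

lemma D_pow_slice_mult:
  assumes t: "t \<in> carrier R" "(D ^^ 2) t = \<zero>" and x: "x \<in> carrier R"
  shows "(D ^^ Suc n) (t \<otimes> x) = t \<otimes> (D ^^ Suc n) x \<oplus> [Suc n] \<cdot> (D t \<otimes> (D ^^ n) x)"
proof (induction n)
  case 0
  then show ?case using t x by (simp add: D_mult a_comm)
next
  case (Suc n)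
  let ?y = "D t \<otimes> (D ^^ Suc n) x"
  have D2: "D (D t) = \<zero>" using t by (simp add: numeral_2_eq_2)
  have cl: "t \<otimes> (D ^^ Suc (Suc n)) x \<in> carrier R" "?y \<in> carrier R" using t x by auto
  have "(D ^^ Suc (Suc n)) (t \<otimes> x) = D (t \<otimes> (D ^^ Suc n) x \<oplus> [Suc n] \<cdot> (D t \<otimes> (D ^^ n) x))"
    using Suc.IH by simp
  also have "\<dots> = D (t \<otimes> (D ^^ Suc n) x) \<oplus> D ([Suc n] \<cdot> (D t \<otimes> (D ^^ n) x))"
    using t x by (intro D_add) auto
  also have "D (t \<otimes> (D ^^ Suc n) x) = ?y \<oplus> t \<otimes> (D ^^ Suc (Suc n)) x"
    using t x by (simp add: D_mult)
  also have "D ([Suc n] \<cdot> (D t \<otimes> (D ^^ n) x)) = [Suc n] \<cdot> ?y"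
    using t x D2 by (subst D_add_pow) (auto simp: D_mult)
  also have "?y \<oplus> t \<otimes> (D ^^ Suc (Suc n)) x \<oplus> [Suc n] \<cdot> ?y
      = t \<otimes> (D ^^ Suc (Suc n)) x \<oplus> [Suc (Suc n)] \<cdot> ?y"
    using cl add.nat_pow_Suc2[of ?y "Suc n"] add.nat_pow_closed[OF cl(2), of "Suc n"]
    by (metis a_assoc a_comm)
  finally show ?case .
qed

end

section \<open>Homogeneous local slices and constant terms\<close>

locale graded_local_slice = graded_ring G R B + domain R + derivation R D
  for G :: "('g, 'm) monoid_scheme" and R :: "('a, 'n) ring_scheme" (structure)
    and B :: "'g \<Rightarrow> 'a set" and D :: "'a \<Rightarrow> 'a" +
  fixes t :: 'a
  assumes char_zero: "char_zero R"
    and nilpotent: "locally_nilpotent R D"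
    and homogeneous: "homogeneous_map G B D"
    and slice_homogeneous: "t \<in> homogeneous_elements G B"
    and D_slice: "D t \<noteq> \<zero>"
    and D2_slice: "(D ^^ 2) t = \<zero>"
begin

lemma slice_closed [simp, intro]: "t \<in> carrier R"
  using slice_homogeneous homogeneous_closed by blast

lemma add_pow_nonzero:
  assumes "x \<in> carrier R" "x \<noteq> \<zero>" "n > 0"
  shows "[(n::nat)] \<cdot> x \<noteq> \<zero>"
proof -
  have "[n] \<cdot> x = ([n] \<cdot> \<one>) \<otimes> x" using assms add_pow_ldistr by simp
  then show ?thesis using assms char_zero by (simp add: char_zero_def integral_iff)
qed

text \<open>This is the multiplicative set \<open>S\<close> of the localisation. Its members are
  homogeneous, so clearing a denominator only translates degrees; they are constants, so it commutes
  with \<open>D\<close>.\<close>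

abbreviation denominators :: "'a set" where
  "denominators \<equiv> homogeneous_elements G B \<inter> constants - {\<zero>}"

lemma denominators_closed [simp]: "s \<in> denominators \<Longrightarrow> s \<in> carrier R"
  by (simp add: constants_iff)

lemma denominators_mult: "\<lbrakk>r \<in> denominators; s \<in> denominators\<rbrakk> \<Longrightarrow> r \<otimes> s \<in> denominators"
  using homogeneous_mult constants_mult integral_iff by (auto simp: constants_iff)

lemma denominators_add_pow:
  assumes "s \<in> denominators" "n > 0"
  shows "[(n::nat)] \<cdot> s \<in> denominators"
proof -
  have "D ([n] \<cdot> s) = \<zero>" using assms D_add_pow[of s n] by (simp add: constants_iff)
  then show ?thesis
    using assms homogeneous_add_pow[of s n] add_pow_nonzero[of s n] by (simp add: constants_iff)
qed

text \<open>Comparing components of the degree of \<open>t\<close> in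
  \<open>t \<otimes> \<one> = t\<close> gives \<open>t \<otimes> e = t\<close>, where
  \<open>e\<close> is the component of \<open>\<one>\<close> of neutral degree. Cancelling
  \<open>t\<close> shows that \<open>\<one>\<close> is homogeneous.\<close>

lemma one_denominator: "\<one> \<in> denominators"
proof -
  define e where "e = homogeneous_component \<one>\<^bsub>G\<^esub> \<one>"
  obtain i where i: "i \<in> carrier G" "t \<in> B i"
    using slice_homogeneous by (auto simp: homogeneous_elements_def)
  have "homogeneous_component (\<one>\<^bsub>G\<^esub> \<otimes>\<^bsub>G\<^esub> i) (t \<otimes> \<one>) = t \<otimes> e"
    unfolding e_def using i by (intro homogeneous_component_mult) auto
  then have "t \<otimes> e = t \<otimes> \<one>"
    using i homogeneous_component_homogeneous by simp
  moreover have "t \<noteq> \<zero>" using D_slice by auto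
  ultimately have "e = \<one>"
    using m_lcancel[of t e \<one>] by (simp add: e_def)
  moreover have "e \<in> B \<one>\<^bsub>G\<^esub>" unfolding e_def by (intro homogeneous_component(1)) auto
  ultimately show ?thesis by (auto simp: homogeneous_elements_def constants_iff)
qed

text \<open>The value is n! times the n-th power of \<open>D t\<close>; all that matters is that it
  is an admissible denominator.\<close>

lemma D_pow_slice_power: "\<exists>s\<in>denominators. (D ^^ n) (t [^] n) = s"
proof (induction n)
  case 0
  then show ?case using one_denominator by simp
next
  case (Suc n)
  then obtain s where s: "s \<in> denominators" "(D ^^ n) (t [^] n) = s" by blast
  have "D s = \<zero>" using s(1) by (simp add: constants_iff)
  then have "(D ^^ Suc n) (t [^] Suc n) = [Suc n] \<cdot> (D t \<otimes> s)"
    using D_pow_slice_mult[OF slice_closed D2_slice, of "t [^] n" n] s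
    by (simp add: m_comm[of "t [^] n" t])
  moreover have Dt: "D t \<in> denominators"
    using D_slice D2_slice homogeneous_map_homogeneous[OF homogeneous slice_homogeneous]
    by (simp add: constants_iff numeral_2_eq_2)
  have "[Suc n] \<cdot> (D t \<otimes> s) \<in> denominators"
    using denominators_add_pow denominators_mult Dt s(1) by blast
  ultimately show ?case by metis
qed

text \<open>Over the localisation \<open>b\<close> is a polynomial in \<open>t\<close> with constant
  coefficients; \<alpha> is its constant term after clearing denominators. The induction removes the
  leading term.\<close>

lemma decomposition_nilpotent:
  assumes "b \<in> carrier R" "(D ^^ n) b = \<zero>"
  shows "\<exists>s\<in>denominators. \<exists>\<alpha>\<in>constants. \<exists>c\<in>carrier R. s \<otimes> b = \<alpha> \<oplus> t \<otimes> c"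
  using assms
proof (induction n arbitrary: b)
  case 0
  then show ?case
    using one_denominator by (intro bexI[of _ \<one>] bexI[of _ \<zero>]) (auto simp: constants_iff)
next
  case (Suc n)
  show ?case
  proof (cases n)
    \<comment> \<open>Here \<open>b\<close> is itself a constant. The case is separate because the
      zeroth power of \<open>t\<close> is not a multiple of \<open>t\<close>.\<close>
    case 0
    then show ?thesis using Suc.prems one_denominator
      by (intro bexI[of _ \<one>] bexI[of _ b] bexI[of _ \<zero>]) (auto simp: constants_iff)
  next
    case (Suc m)
    obtain r where r: "r \<in> denominators" "(D ^^ n) (t [^] n) = r" using D_pow_slice_power by blast
    define \<beta> where "\<beta> = (D ^^ n) b"
    have \<beta>: "\<beta> \<in> constants" "\<beta> \<in> carrier R" using Suc.prems by (auto simp: \<beta>_def constants_iff)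
    have rc: "r \<in> constants" "r \<in> carrier R" using r by auto
    \<comment> \<open>The coefficients are chosen so that the \<open>n\<close>-th derivatives
      \<open>r \<otimes> \<beta>\<close> and \<open>\<beta> \<otimes> r\<close> of the two terms
      cancel.\<close>
    define b' where "b' = r \<otimes> b \<oplus> \<ominus> (\<beta> \<otimes> t [^] n)"
    have b': "b' \<in> carrier R" using rc \<beta> Suc.prems by (simp add: b'_def)
    have "(D ^^ n) b' = r \<otimes> \<beta> \<oplus> \<ominus> (\<beta> \<otimes> r)"
      using rc \<beta> Suc.prems r(2)
      by (simp add: b'_def D_pow_add D_pow_uminus D_pow_constant_mult \<beta>_def)
    also have "\<dots> = \<zero>" using rc \<beta> by (simp add: m_comm r_neg)
    finally obtain s \<alpha> c where sac: "s \<in> denominators" "\<alpha> \<in> constants" "c \<in> carrier R"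
        "s \<otimes> b' = \<alpha> \<oplus> t \<otimes> c"
      using Suc.IH[OF b'] by blast
    have cl: "s \<in> carrier R" "\<alpha> \<in> carrier R" "t [^] m \<in> carrier R"
      using sac by (auto simp: constants_iff)
    have tn: "t [^] n = t \<otimes> t [^] m" using Suc m_comm by simp
    have "s \<otimes> r \<otimes> b = s \<otimes> b' \<oplus> s \<otimes> (\<beta> \<otimes> (t \<otimes> t [^] m))"
      unfolding b'_def tn using cl rc \<beta> Suc.prems slice_closed by algebra
    also have "\<dots> = \<alpha> \<oplus> t \<otimes> (c \<oplus> s \<otimes> \<beta> \<otimes> t [^] m)"
      unfolding sac(4) using cl \<beta> sac(3) slice_closed by algebra
    finally show ?thesis
      using denominators_mult[OF sac(1) r(1)] sac(2,3) cl \<beta>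
      by (intro bexI[of _ "s \<otimes> r"] bexI[of _ \<alpha>] bexI[of _ "c \<oplus> s \<otimes> \<beta> \<otimes> t [^] m"]) auto
  qed
qed

lemma decomposition:
  assumes "b \<in> carrier R"
  obtains s \<alpha> c where "s \<in> denominators" "\<alpha> \<in> constants" "c \<in> carrier R" "s \<otimes> b = \<alpha> \<oplus> t \<otimes> c"
  using decomposition_nilpotent[OF assms] nilpotent assms unfolding locally_nilpotent_def by blast

text \<open>Multiplication by \<open>t\<close> raises the degree with respect to \<open>D\<close> by
  one: the leading derivative of the product is a positive multiple of \<open>D t\<close> times that
  of \<open>c\<close>, which is nonzero in a domain of characteristic zero.\<close>

lemma slice_mult_D_pow:
  assumes "c \<in> carrier R" "(D ^^ Suc n) (t \<otimes> c) = \<zero>"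
  shows "(D ^^ n) c = \<zero>"
proof (rule ccontr)
  assume nz: "(D ^^ n) c \<noteq> \<zero>"
  obtain k where k: "(D ^^ k) c = \<zero>" using nilpotent assms(1) unfolding locally_nilpotent_def by blast
  \<comment> \<open>\<open>m\<close> is the degree of \<open>c\<close> with respect to
    \<open>D\<close>; it exists because the iterates eventually vanish, and \<open>nz\<close> gives
    \<open>n \<le> m\<close>.\<close>
  define m where "m = (GREATEST m. (D ^^ m) c \<noteq> \<zero>)"
  have bd: "\<And>m. (D ^^ m) c \<noteq> \<zero> \<Longrightarrow> m \<le> k"
    using D_pow_eq_zero_mono[OF k] by (meson nat_le_linear)
  have m: "(D ^^ m) c \<noteq> \<zero>" "n \<le> m"
    unfolding m_def using GreatestI_nat[of "\<lambda>m. (D ^^ m) c \<noteq> \<zero>", OF nz bd]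
      Greatest_le_nat[of "\<lambda>m. (D ^^ m) c \<noteq> \<zero>", OF nz bd] by blast+
  have "(D ^^ Suc m) c = \<zero>"
    using Greatest_le_nat[of "\<lambda>m. (D ^^ m) c \<noteq> \<zero>", OF _ bd] unfolding m_def
    by (metis Suc_n_not_le_n)
  then have "(D ^^ Suc m) (t \<otimes> c) = [Suc m] \<cdot> (D t \<otimes> (D ^^ m) c)"
    using D_pow_slice_mult[OF slice_closed D2_slice assms(1), of m] assms(1) by simp
  moreover have "(D ^^ Suc m) (t \<otimes> c) = \<zero>"
    using D_pow_eq_zero_mono[OF assms(2), of "Suc m"] m(2) by blast
  ultimately show False
    using add_pow_nonzero[of "D t \<otimes> (D ^^ m) c" "Suc m"] m(1) D_slice assms(1)
    by (simp add: integral_iff)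
qed

section \<open>The height one prime contracted from the slice\<close>

text \<open>The contraction is described by cleared denominators, so that the localisation itself
  need not be constructed.\<close>

definition slice_prime :: "'a set" where
  "slice_prime = {b \<in> carrier R. \<exists>s\<in>denominators. \<exists>c\<in>carrier R. s \<otimes> b = t \<otimes> c}"

lemma slice_primeE:
  assumes "b \<in> slice_prime"
  obtains s c where "s \<in> denominators" "c \<in> carrier R" "s \<otimes> b = t \<otimes> c"
  using assms unfolding slice_prime_def by blast

lemma slice_prime_closed: "b \<in> slice_prime \<Longrightarrow> b \<in> carrier R"
  by (simp add: slice_prime_def)

lemma slice_primeI:
  "\<lbrakk>s \<in> denominators; c \<in> carrier R; b \<in> carrier R; s \<otimes> b = t \<otimes> c\<rbrakk> \<Longrightarrow> b \<in> slice_prime"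
  unfolding slice_prime_def by blast

lemma slice_mem: "t \<in> slice_prime"
  using one_denominator by (intro slice_primeI[of \<one> \<one>]) auto

lemma slice_prime_ideal: "ideal slice_prime R"
proof (rule idealI)
  show "subgroup slice_prime (add_monoid R)"
  proof
    show "slice_prime \<subseteq> carrier (add_monoid R)" by (auto simp: slice_prime_def)
  next
    fix x y assume "x \<in> slice_prime" "y \<in> slice_prime"
    then obtain r c s d where *: "r \<in> denominators" "c \<in> carrier R" "r \<otimes> x = t \<otimes> c"
      "s \<in> denominators" "d \<in> carrier R" "s \<otimes> y = t \<otimes> d" "x \<in> carrier R" "y \<in> carrier R"
      by (metis slice_primeE slice_prime_closed)
    have rs: "r \<in> carrier R" "s \<in> carrier R" using * by auto
    have "(r \<otimes> s) \<otimes> (x \<oplus> y) = s \<otimes> (r \<otimes> x) \<oplus> r \<otimes> (s \<otimes> y)"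
      using *(7,8) rs by algebra
    also have "\<dots> = t \<otimes> (s \<otimes> c \<oplus> r \<otimes> d)"
      unfolding *(3,6) using *(2,5) rs slice_closed by algebra
    finally have "x \<oplus> y \<in> slice_prime"
      using * rs by (intro slice_primeI[OF denominators_mult[OF *(1,4)]]) auto
    then show "x \<otimes>\<^bsub>add_monoid R\<^esub> y \<in> slice_prime" by simp
  next
    show "\<one>\<^bsub>add_monoid R\<^esub> \<in> slice_prime"
      using one_denominator by (auto intro!: slice_primeI[of \<one> \<zero>])
  next
    fix x assume "x \<in> slice_prime"
    then obtain s c where *: "s \<in> denominators" "c \<in> carrier R" "s \<otimes> x = t \<otimes> c" "x \<in> carrier R"
      by (metis slice_primeE slice_prime_closed)
    then have "\<ominus> x \<in> slice_prime"
      using denominators_closed[OF *(1)]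
      by (intro slice_primeI[OF *(1), of "\<ominus> c"]) (auto simp: r_minus)
    then show "inv\<^bsub>add_monoid R\<^esub> x \<in> slice_prime" by (simp add: a_inv_def)
  qed
next
  fix a x assume a: "a \<in> slice_prime" and x: "x \<in> carrier R"
  obtain s c where *: "s \<in> denominators" "c \<in> carrier R" "s \<otimes> a = t \<otimes> c"
    using slice_primeE[OF a] by blast
  have cl: "a \<in> carrier R" "s \<in> carrier R" using a slice_prime_closed * by auto
  have "s \<otimes> (x \<otimes> a) = x \<otimes> (s \<otimes> a)" using cl x by algebra
  also have "\<dots> = t \<otimes> (x \<otimes> c)" unfolding *(3) using *(2) x slice_closed by algebra
  finally show "x \<otimes> a \<in> slice_prime" using * cl x by (intro slice_primeI[OF *(1)]) auto
  then show "a \<otimes> x \<in> slice_prime" using cl x m_comm by simp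
qed (rule ring_axioms)

text \<open>A multiple \<open>t \<otimes> c\<close> that is a constant has
  \<open>c = \<zero>\<close>, since a nonzero \<open>c\<close> would give it positive degree with
  respect to \<open>D\<close>.\<close>

lemma constants_inter_slice_prime:
  assumes "x \<in> constants" "x \<in> slice_prime"
  shows "x = \<zero>"
proof -
  obtain s c where *: "s \<in> denominators" "c \<in> carrier R" "s \<otimes> x = t \<otimes> c"
    using slice_primeE[OF assms(2)] by blast
  have "s \<otimes> x \<in> constants" using constants_mult *(1) assms(1) by blast
  then have "c = \<zero>"
    using slice_mult_D_pow[OF *(2), of 0] *(3) by (simp add: constants_iff)
  then have "s \<otimes> x = \<zero>" using *(3) by simp
  then show ?thesis
    using *(1) assms(1) integral_iff by (auto simp: constants_iff)
qed

text \<open>Modulo the ideal, elements are represented up to denominators by their constant terms.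
  Constants form a domain meeting the ideal only in zero.\<close>

lemma slice_prime_prime: "primeideal slice_prime R"
proof (rule primeidealI[OF slice_prime_ideal is_cring])
  show "carrier R \<noteq> slice_prime"
    using constants_inter_slice_prime[of \<one>] by (auto simp: constants_iff)
next
  fix x y assume x: "x \<in> carrier R" and y: "y \<in> carrier R" and xy: "x \<otimes> y \<in> slice_prime"
  interpret P: ideal slice_prime R by (rule slice_prime_ideal)
  obtain r \<alpha> c where 1: "r \<in> denominators" "\<alpha> \<in> constants" "c \<in> carrier R" "r \<otimes> x = \<alpha> \<oplus> t \<otimes> c"
    using decomposition[OF x] by blast
  obtain s \<beta> d where 2: "s \<in> denominators" "\<beta> \<in> constants" "d \<in> carrier R" "s \<otimes> y = \<beta> \<oplus> t \<otimes> d"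
    using decomposition[OF y] by blast
  have cl: "r \<in> carrier R" "s \<in> carrier R" "\<alpha> \<in> carrier R" "\<beta> \<in> carrier R" "t \<in> carrier R"
    using 1(1,2) 2(1,2) by (auto simp: constants_iff)
  \<comment> \<open>The subtracted bracket collects all terms of the product that are divisible by
    \<open>t\<close>.\<close>
  have "\<alpha> \<otimes> \<beta> = (\<alpha> \<oplus> t \<otimes> c) \<otimes> (\<beta> \<oplus> t \<otimes> d) \<oplus> \<ominus> (t \<otimes> (c \<otimes> \<beta> \<oplus> \<alpha> \<otimes> d \<oplus> t \<otimes> c \<otimes> d))"
    using cl 1(3) 2(3) by algebra
  also have "(\<alpha> \<oplus> t \<otimes> c) \<otimes> (\<beta> \<oplus> t \<otimes> d) = (r \<otimes> s) \<otimes> (x \<otimes> y)"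
    unfolding 1(4)[symmetric] 2(4)[symmetric] using cl x y by algebra
  finally have "\<alpha> \<otimes> \<beta> \<in> slice_prime"
    using xy slice_mem cl 1(3) 2(3) by (simp add: P.I_l_closed P.I_r_closed)
  then have "\<alpha> = \<zero> \<or> \<beta> = \<zero>"
    using constants_inter_slice_prime constants_mult 1(2) 2(2) cl integral by blast
  then show "x \<in> slice_prime \<or> y \<in> slice_prime"
    using slice_primeI[OF 1(1,3) x] slice_primeI[OF 2(1,3) y] 1(3,4) 2(3,4) by auto
qed

text \<open>A nonzero element of \<open>Q\<close> is, up to a denominator, \<open>t\<close> times an
  element of smaller degree with respect to \<open>D\<close>. Primeness puts one of the two factors
  in \<open>Q\<close>, and descent on the degree must end with \<open>t\<close>.\<close>

lemma slice_prime_minimal: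
  assumes Q: "primeideal Q R" and sub: "Q \<subseteq> slice_prime" and nz: "Q \<noteq> {\<zero>}"
  shows "Q = slice_prime"
proof -
  interpret Q: primeideal Q R by fact
  have slice: "t \<in> Q" if "b \<in> Q" "b \<noteq> \<zero>" "(D ^^ n) b = \<zero>" for b n
    using that
  proof (induction n arbitrary: b)
    case 0
    then show ?case by simp
  next
    case (Suc n)
    obtain s c where *: "s \<in> denominators" "c \<in> carrier R" "s \<otimes> b = t \<otimes> c"
      using Suc.prems(1) sub slice_primeE by blast
    have cl: "s \<in> carrier R" "b \<in> carrier R" "s \<noteq> \<zero>" "s \<in> constants" using * Suc.prems by auto
    have "(D ^^ Suc n) (t \<otimes> c) = \<zero>"
      unfolding *(3)[symmetric] using D_pow_constant_mult[of s b "Suc n"] cl Suc.prems(3) by simp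
    then have "(D ^^ n) c = \<zero>" using slice_mult_D_pow *(2) by blast
    moreover have "c \<noteq> \<zero>" using *(3) cl Suc.prems(2) integral_iff[of s b] by auto
    moreover have "t \<in> Q \<or> c \<in> Q"
      using Q.I_prime[OF slice_closed *(2)] Q.I_l_closed[OF Suc.prems(1) cl(1)] *(3) by simp
    ultimately show ?case using Suc.IH by blast
  qed
  obtain b where b: "b \<in> Q" "b \<noteq> \<zero>" using nz Q.zero_closed by blast
  have t: "t \<in> Q"
    using slice[OF b] nilpotent Q.Icarr[OF b(1)] unfolding locally_nilpotent_def by blast
  have "x \<in> Q" if x: "x \<in> slice_prime" for x
  proof -
    obtain s c where *: "s \<in> denominators" "c \<in> carrier R" "s \<otimes> x = t \<otimes> c"
      using slice_primeE[OF x] by blast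
    then have "s \<otimes> x \<in> Q" using t Q.I_r_closed by simp
    \<comment> \<open>A nonzero constant lies outside \<open>slice_prime\<close>, hence outside
      \<open>Q\<close>, and can be cancelled.\<close>
    moreover have "s \<notin> Q" using *(1) sub constants_inter_slice_prime by blast
    ultimately show ?thesis
      using Q.I_prime[of s x] slice_prime_closed[OF x] denominators_closed[OF *(1)] by blast
  qed
  then show ?thesis using sub by blast
qed

text \<open>The chain from the zero ideal gives height at least one. In a longer chain the next to
  last prime would be nonzero and properly contained in \<open>slice_prime\<close>, against
  minimality.\<close>

lemma slice_prime_Spec1: "slice_prime \<in> Spec1 R"
proof -
  let ?N = "{n. \<exists>C. (\<forall>k\<le>n. primeideal (C k) R) \<and> (\<forall>k<n. C k \<subset> C (Suc k)) \<and> C n = slice_prime}"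
  have "t \<noteq> \<zero>" using D_slice by auto
  then have psub: "{\<zero>} \<subset> slice_prime"
    using slice_mem additive_subgroup.zero_closed[OF ideal.axioms(1)[OF slice_prime_ideal]] by blast
  have "1 \<in> ?N"
    using slice_prime_prime zeroprimeideal psub
    by (auto intro!: exI[of _ "\<lambda>k. if k = 0 then {\<zero>} else slice_prime"])
  moreover have "n \<le> 1" if n: "n \<in> ?N" for n
  proof (rule ccontr)
    assume "\<not> n \<le> 1"
    then obtain m where m: "n = Suc (Suc m)" by (metis One_nat_def not_less_eq_eq not0_implies_Suc le0)
    from n obtain C where C: "\<forall>k\<le>n. primeideal (C k) R" "\<forall>k<n. C k \<subset> C (Suc k)" "C n = slice_prime"
      by blast
    have "\<zero> \<in> C m"
      using C(1) m additive_subgroup.zero_closed ideal.axioms(1) primeideal.axioms(1)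
      by (metis le_add2 plus_1_eq_Suc le_SucI)
    then have "C (Suc m) \<noteq> {\<zero>}" using C(2) m by (metis lessI less_SucI psubset_eq subset_singletonD empty_iff)
    moreover have "C (Suc m) \<subset> slice_prime" "primeideal (C (Suc m)) R" using C m by auto
    ultimately show False using slice_prime_minimal by blast
  qed
  ultimately have "(SUP n\<in>?N. enat n) = 1"
    by (intro antisym SUP_least SUP_upper2[of 1]) (auto simp: one_enat_def)
  then show ?thesis using slice_prime_prime by (simp add: Spec1_def prime_height_def)
qed

text \<open>Taking one component of the equation \<open>s \<otimes> x = t \<otimes> c\<close> leaves
  an equation of the same shape, with the same \<open>s\<close>, because \<open>s\<close> and
  \<open>t\<close> are homogeneous.\<close>

lemma slice_prime_homogeneous: "homogeneous_ideal G R B slice_prime"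
proof (rule homogeneous_idealI[OF slice_prime_ideal])
  fix x i assume x: "x \<in> slice_prime" and i: "i \<in> carrier G"
  obtain s c where *: "s \<in> denominators" "c \<in> carrier R" "s \<otimes> x = t \<otimes> c"
    using slice_primeE[OF x] by blast
  obtain j where j: "j \<in> carrier G" "s \<in> B j" using *(1) by (auto simp: homogeneous_elements_def)
  obtain k where k: "k \<in> carrier G" "t \<in> B k"
    using slice_homogeneous by (auto simp: homogeneous_elements_def)
  \<comment> \<open>\<open>l\<close> is the degree in which \<open>c\<close> must be taken for both
    sides to have the degree of \<open>s\<close> times \<open>i\<close>.\<close>
  define l where "l = i \<otimes>\<^bsub>G\<^esub> j \<otimes>\<^bsub>G\<^esub> inv\<^bsub>G\<^esub> k"
  have l: "l \<in> carrier G" "l \<otimes>\<^bsub>G\<^esub> k = i \<otimes>\<^bsub>G\<^esub> j"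
    using i j k by (auto simp: l_def degrees.m_assoc)
  have "s \<otimes> homogeneous_component i x = t \<otimes> homogeneous_component l c"
    using homogeneous_component_mult[OF j(2,1) slice_prime_closed[OF x] i]
      homogeneous_component_mult[OF k(2,1) *(2) l(1)] *(3) l(2) by simp
  from slice_primeI[OF *(1) _ _ this] show "homogeneous_component i x \<in> slice_prime"
    using *(2) l(1) i slice_prime_closed[OF x] by simp
qed

text \<open>A homogeneous \<open>D\<close> sends components of \<open>x\<close> to components of
  \<open>D x\<close>, so its kernel is graded.\<close>

lemma homogeneous_component_constants:
  assumes "x \<in> constants" "i \<in> carrier G"
  shows "homogeneous_component i x \<in> constants"
proof -
  obtain d where d: "d \<in> carrier G" "\<And>i. i \<in> carrier G \<Longrightarrow> D ` B i \<subseteq> B (i \<otimes>\<^bsub>G\<^esub> d)"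
    using homogeneous unfolding homogeneous_map_def by blast
  have "homogeneous_component (i \<otimes>\<^bsub>G\<^esub> d) (D x) = D (homogeneous_component i x)"
    using assms d by (intro homogeneous_component_shift) (auto simp: D_add constants_iff)
  moreover have "homogeneous_component (i \<otimes>\<^bsub>G\<^esub> d) \<zero> = \<zero>"
    using homogeneous_component_homogeneous[of "i \<otimes>\<^bsub>G\<^esub> d" "i \<otimes>\<^bsub>G\<^esub> d" \<zero>] zero_in_component assms(2) d(1)
    by simp
  moreover have "D x = \<zero>" "homogeneous_component i x \<in> carrier R"
    using assms by (auto simp: constants_iff)
  ultimately show ?thesis unfolding constants_iff by metis
qed

text \<open>Nonzero homogeneous constants avoid the prime, which gives one inclusion. Conversely a
  degree \<open>i\<close> at the prime is the quotient of the degrees of two such constants: a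
  component of the constant term of \<open>x\<close>, and the denominator \<open>s\<close>.\<close>

lemma degree_group_kernel_eq: "degree_group_kernel G R B D = degree_group_at G B slice_prime"
proof -
  define K where "K = {i \<in> carrier G. B i \<inter> constants \<noteq> {\<zero>}}"
  have K: "degree_group_kernel G R B D = generate G K"
    by (simp add: degree_group_kernel_def degree_group_def subring_grading_def K_def)
  have KI: "i \<in> K" if "i \<in> carrier G" "x \<in> B i" "x \<in> constants" "x \<noteq> \<zero>" for i x
    using that by (auto simp: K_def)
  have KD: "\<exists>x \<in> B i \<inter> constants. x \<noteq> \<zero>" if "i \<in> K" for i
  proof -
    have "\<zero> \<in> B i \<inter> constants"
      using that zero_in_component by (simp add: K_def constants_iff)
    then show ?thesis using that unfolding K_def by blast
  qed
  have Ksub: "K \<subseteq> carrier G" by (auto simp: K_def)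
  have "K \<subseteq> degree_monoid_at G B slice_prime"
    using KD constants_inter_slice_prime Ksub unfolding degree_monoid_at_def by blast
  moreover have "degree_monoid_at G B slice_prime \<subseteq> generate G K"
  proof
    fix i assume "i \<in> degree_monoid_at G B slice_prime"
    then obtain x where i: "i \<in> carrier G" and x: "x \<in> B i" "x \<notin> slice_prime"
      by (auto simp: degree_monoid_at_def)
    have xR: "x \<in> carrier R" using i x by simp
    obtain s \<alpha> c where *: "s \<in> denominators" "\<alpha> \<in> constants" "c \<in> carrier R" "s \<otimes> x = \<alpha> \<oplus> t \<otimes> c"
      using decomposition[OF xR] by blast
    obtain j where j: "j \<in> carrier G" "s \<in> B j" using *(1) by (auto simp: homogeneous_elements_def)
    obtain k where k: "k \<in> carrier G" "t \<in> B k"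
      using slice_homogeneous by (auto simp: homogeneous_elements_def)
    let ?ij = "i \<otimes>\<^bsub>G\<^esub> j"
    define l where "l = ?ij \<otimes>\<^bsub>G\<^esub> inv\<^bsub>G\<^esub> k"
    have ij: "?ij \<in> carrier G" using i j by simp
    have l: "l \<in> carrier G" "l \<otimes>\<^bsub>G\<^esub> k = ?ij"
      using i j k by (auto simp: l_def degrees.m_assoc)
    define \<gamma> where "\<gamma> = homogeneous_component ?ij \<alpha>"
    have \<alpha>R: "\<alpha> \<in> carrier R" using *(2) by (simp add: constants_iff)
    have "homogeneous_component ?ij (s \<otimes> x) = s \<otimes> x"
      using homogeneous_component_mult[OF j(2,1) xR i] homogeneous_component_homogeneous[OF i i x(1)]
      by simp
    moreover have "homogeneous_component ?ij (t \<otimes> c) = t \<otimes> homogeneous_component l c"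
      using homogeneous_component_mult[OF k(2,1) *(3) l(1)] l(2) by simp
    ultimately have eq: "s \<otimes> x = \<gamma> \<oplus> t \<otimes> homogeneous_component l c"
      unfolding *(4) \<gamma>_def using homogeneous_component_add[OF \<alpha>R _ ij, of "t \<otimes> c"] *(3) by simp
    \<comment> \<open>Otherwise \<open>s \<otimes> x\<close> would be a multiple of
      \<open>t\<close>, placing \<open>x\<close> in the prime.\<close>
    have "\<gamma> \<noteq> \<zero>"
      using eq slice_primeI[OF *(1) _ xR, of "homogeneous_component l c"] *(3) l(1) x(2) by auto
    then have "?ij \<in> K"
      using KI[OF ij] homogeneous_component(1)[OF \<alpha>R ij] homogeneous_component_constants[OF *(2) ij]
      by (simp add: \<gamma>_def)
    moreover have "j \<in> K" using KI[OF j] *(1) by blast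
    ultimately have "?ij \<otimes>\<^bsub>G\<^esub> inv\<^bsub>G\<^esub> j \<in> generate G K" by (blast intro: generate.intros)
    then show "i \<in> generate G K" using i j by (simp add: degrees.m_assoc)
  qed
  ultimately show ?thesis
    unfolding K degree_group_at_def
    by (meson Ksub degrees.generate_is_subgroup degrees.generate_subgroup_incl degrees.mono_generate
        subset_antisym)
qed

end

section \<open>Existence of a slice and comparison of degree groups\<close>

lemma (in graded_ring) homogeneous_local_slice:
  assumes D: "D \<in> HLND G R B" "D \<noteq> zero_derivation R"
  obtains t where "t \<in> homogeneous_elements G B" "D t \<noteq> \<zero>" "(D ^^ 2) t = \<zero>"
proof -
  interpret derivation R D using D(1) by unfold_locales (simp add: HLND_def)
  have "\<exists>b\<in>homogeneous_elements G B. D b \<noteq> \<zero>"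
  proof (rule ccontr)
    assume "\<not> ?thesis"
    then have z: "\<And>i x. \<lbrakk>i \<in> carrier G; x \<in> B i\<rbrakk> \<Longrightarrow> D x = \<zero>"
      by (auto simp: homogeneous_elements_def)
    have "D x = \<zero>" if x: "x \<in> carrier R" for x
    proof -
      have "D x = (\<Oplus>i\<in>component_support x. D (homogeneous_component i x))"
        using additive_finsum[of D, OF _ D_add homogeneous_component(2)[OF x],
            of "\<lambda>i. homogeneous_component i x"] homogeneous_component(3)[OF x] x by auto
      also have "\<dots> = \<zero>"
        using z homogeneous_component(1)[OF x] by (intro add.finprod_one_eqI) auto
      finally show ?thesis .
    qed
    \<comment> \<open>Vanishing on the carrier identifies \<open>D\<close> with
      \<open>zero_derivation R\<close> only together with its fixed value outside the
      carrier.\<close>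
    moreover have "D \<in> extensional (carrier R)"
      using derivation by (auto simp: derivations_def PiE_def)
    ultimately have "D = zero_derivation R"
      by (auto simp: zero_derivation_def fun_eq_iff extensional_def)
    then show False using D(2) by simp
  qed
  then obtain b where b: "b \<in> homogeneous_elements G B" "D b \<noteq> \<zero>" by blast
  have hom: "(D ^^ n) b \<in> homogeneous_elements G B" for n
    using b(1) homogeneous_map_homogeneous[of D] D(1) by (induction n) (auto simp: HLND_def)
  have "\<exists>n. (D ^^ n) b = \<zero>"
    using D(1) homogeneous_closed[OF b(1)] by (auto simp: HLND_def locally_nilpotent_def)
  then obtain n where n: "(D ^^ n) b = \<zero>" "\<And>m. m < n \<Longrightarrow> (D ^^ m) b \<noteq> \<zero>"
    using exists_least_iff[of "\<lambda>n. (D ^^ n) b = \<zero>"] by blast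
  \<comment> \<open>As \<open>D b\<close> is nonzero, at least two steps lead to zero; the iterate
    two steps before is the slice.\<close>
  have "n \<noteq> 0" "n \<noteq> 1" using n(1) b(2) by (auto intro: ccontr)
  then obtain m where m: "n = Suc (Suc m)" by (metis One_nat_def not0_implies_Suc)
  show thesis
    using that[of "(D ^^ m) b"] hom n(1) n(2)[of "Suc m"] m by (simp add: numeral_2_eq_2)
qed

lemma (in graded_ring) exists_height_one_prime:
  assumes "domain R" "char_zero R" and D: "D \<in> HLND G R B" "D \<noteq> zero_derivation R"
  shows "\<exists>P \<in> Spec1 R. homogeneous_ideal G R B P \<and>
          (\<exists>t \<in> homogeneous_elements G B \<inter> P. D t \<noteq> \<zero> \<and> (D ^^ 2) t = \<zero>) \<and>
          degree_group_quotient G R B P = degree_group_kernel G R B D"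
proof -
  obtain t where t: "t \<in> homogeneous_elements G B" "D t \<noteq> \<zero>" "(D ^^ 2) t = \<zero>"
    using homogeneous_local_slice[OF D] by blast
  interpret dom: domain R by fact
  interpret graded_local_slice G R B D t
    using t D(1) assms(2) by unfold_locales (auto simp: HLND_def)
  show ?thesis
    using slice_prime_Spec1 slice_prime_homogeneous slice_mem t
      degree_group_quotient_eq[OF slice_prime_ideal] degree_group_kernel_eq
    by (intro bexI[of _ slice_prime]) auto
qed

lemma (in graded_ring) codim1_degree_group_subset:
  "codim1_degree_group G R B \<subseteq> degree_group G R B"
proof (cases "Spec1 R = {}")
  case False
  then obtain P where P: "P \<in> Spec1 R" by blast
  then have "\<zero> \<in> P"
    by (simp add: Spec1_def additive_subgroup.zero_closed ideal.axioms(1) primeideal.axioms(1))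
  then show ?thesis
    using degree_group_at_subset[of P] P by (auto simp: codim1_degree_group_def)
qed (simp add: codim1_degree_group_def)

lemma (in graded_ring) degree_group_kernel_subset:
  assumes "derivation R D"
  shows "degree_group_kernel G R B D \<subseteq> degree_group G R B"
proof -
  interpret derivation R D by fact
  show ?thesis
    unfolding degree_group_kernel_def degree_group_def subring_grading_def
    by (intro degrees.mono_generate) (auto simp: constants_iff)
qed

text \<open>The zero derivation has no slice, so part (b) treats it separately: its kernel is the
  whole ring.\<close>

lemma (in graded_ring) degree_group_kernel_zero:
  "degree_group_kernel G R B (zero_derivation R) = degree_group G R B"
proof -
  have "a_kernel R R (zero_derivation R) = carrier R"
    by (auto simp: a_kernel_def' zero_derivation_def)
  then have "subring_grading B (a_kernel R R (zero_derivation R)) i = B i" if "i \<in> carrier G" for i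
    using component_subset[OF that] by (auto simp: subring_grading_def)
  then show ?thesis
    unfolding degree_group_kernel_def degree_group_def by (auto intro!: arg_cong[of _ _ "generate G"])
qed

text \<open>For nonzero \<open>D\<close> the prime from part (a) is one of those intersected over,
  and its term equals the degree group of the kernel.\<close>

lemma (in graded_ring) codim1_subset_degree_group_kernel:
  assumes "domain R" "char_zero R" and D: "D \<in> HLND G R B"
  shows "codim1_degree_group G R B \<subseteq> degree_group_kernel G R B D"
proof (cases "D = zero_derivation R")
  case True
  then show ?thesis using degree_group_kernel_zero codim1_degree_group_subset by simp
next
  case False
  then obtain P where P: "P \<in> Spec1 R" "degree_group_quotient G R B P = degree_group_kernel G R B D"
    using exists_height_one_prime[OF assms] by blast
  then have "ideal P R" by (simp add: Spec1_def primeideal.axioms(1))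
  then have "degree_group_kernel G R B D = degree_group_at G B P"
    using degree_group_quotient_eq P(2) by simp
  then show ?thesis using P(1) by (auto simp: codim1_degree_group_def)
qed

theorem theorem4p3:
  fixes G :: "('g, 'm) monoid_scheme" and R :: "('a, 'n) ring_scheme" and B :: "'g \<Rightarrow> 'a set"
  assumes "graded_ring G R B" and "domain R" and "char_zero R"
  shows
    "(\<forall>D \<in> HLND G R B - {zero_derivation R}.
        \<exists>P \<in> Spec1 R. homogeneous_ideal G R B P \<and>
          (\<exists>t \<in> homogeneous_elements G B \<inter> P. D t \<noteq> \<zero>\<^bsub>R\<^esub> \<and> (D ^^ 2) t = \<zero>\<^bsub>R\<^esub>) \<and>
          degree_group_quotient G R B P = degree_group_kernel G R B D) \<and>
     (\<forall>D \<in> HLND G R B.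
        codim1_degree_group G R B \<subseteq> degree_group_kernel G R B D \<and>
        degree_group_kernel G R B D \<subseteq> degree_group G R B) \<and>
     (saturated_in_codim1 G R B \<longrightarrow>
        (\<forall>D \<in> HLND G R B. degree_group_kernel G R B D = degree_group G R B))"
proof -
  interpret graded_ring G R B by fact
  have "derivation R D" if "D \<in> HLND G R B" for D
    using that by unfold_locales (simp add: HLND_def)
  then have "\<forall>D \<in> HLND G R B.
        codim1_degree_group G R B \<subseteq> degree_group_kernel G R B D \<and>
        degree_group_kernel G R B D \<subseteq> degree_group G R B"
    using codim1_subset_degree_group_kernel[OF assms(2,3)] degree_group_kernel_subset by blast
  \<comment> \<open>Saturation makes the two outer groups of the chain in (b) equal, which gives
    (c).\<close>
  then show ?thesis
    using exists_height_one_prime[OF assms(2,3)] unfolding saturated_in_codim1_def by blast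
qed

end
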